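(* Let $G$ be a finitely generated torsion-free nilpotent group and let $g:\mathbb{N}_0\to G$ be a polynomial sequence, with terms $g_i=g(i)$. Then $g_0,g_1,g_2,\ldots$ repeats some value infinitely many times if and only if the sequence is constant.
   Context: $\mathbb{N}_0=\{0,1,2,\ldots\}$ is a commutative semigroup under addition. A polynomial sequence in a group $G$ is a polynomial map $\mathbb{N}_0\to G$, in the following sense. Let $S$ be a nonempty commutative semigroup (written additively) and $G$ a group with identity $1_G$. A map $f:S\to G$ is a polynomial map of degree $-\infty$ if $f(s)=1_G$ for all $s$, and of degree $0$ if it is constant with value different from $1_G$. Thus degree $\le 0$ means constant. Inductively, for $d\in\{0,1,2,\dots\}$, $f$ is a polynomial map of degree $\le d+1$ if for every $s\in S$ both maps $L_s(f):t\mapsto f(s+t)f(t)^{-1}$ and $R_s(f):t\mapsto f(t)^{-1}f(s+t)$ from $S$ to $G$ are polynomial maps of degree $\le d$. The degree of a polynomial map is the least such $d\in\{-\infty,0,1,2,\dots\}$. A map is a polynomial map if it is a polynomial map of degree $\le d$ for some $d$. *)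

theory Defs
  imports "HOL-Algebra.Generated_Groups"
begin

definition fin_gen_group :: "('a, 'b) monoid_scheme \<Rightarrow> bool" where
  "fin_gen_group G \<longleftrightarrow>
     group G \<and> (\<exists>A. finite A \<and> A \<subseteq> carrier G \<and> generate G A = carrier G)"

definition torsion_free_group :: "('a, 'b) monoid_scheme \<Rightarrow> bool" where
  "torsion_free_group G \<longleftrightarrow>
     group G \<and> (\<forall>x\<in>carrier G. \<forall>n::nat. 0 < n \<longrightarrow> x [^]\<^bsub>G\<^esub> n = \<one>\<^bsub>G\<^esub> \<longrightarrow> x = \<one>\<^bsub>G\<^esub>)"

(* The subgroup generated by all commutators of an element of H with an element of K;
   commutator_subgroup G H H is derived G H. *)
definition commutator_subgroup :: "('a, 'b) monoid_scheme \<Rightarrow> 'a set \<Rightarrow> 'a set \<Rightarrow> 'a set" where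
  "commutator_subgroup G H K =
     generate G (\<Union>h\<in>H. \<Union>k\<in>K. {h \<otimes>\<^bsub>G\<^esub> k \<otimes>\<^bsub>G\<^esub> inv\<^bsub>G\<^esub> h \<otimes>\<^bsub>G\<^esub> inv\<^bsub>G\<^esub> k})"

primrec lower_central_series :: "('a, 'b) monoid_scheme \<Rightarrow> nat \<Rightarrow> 'a set" where
  "lower_central_series G 0 = carrier G"
| "lower_central_series G (Suc n) =
     commutator_subgroup G (lower_central_series G n) (carrier G)"

definition nilpotent_group :: "('a, 'b) monoid_scheme \<Rightarrow> bool" where
  "nilpotent_group G \<longleftrightarrow> group G \<and> (\<exists>n. lower_central_series G n = {\<one>\<^bsub>G\<^esub>})"

(* poly_map_le G d f: f is a polynomial map of degree \<le> d into G. The base case d = 0 covers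
   both degree 0 (constant, value not the identity) and degree minus infinity (constantly the
   identity), so it is exactly constancy; hence indexing the bound by nat loses no map. *)
primrec poly_map_le ::
  "('a, 'b) monoid_scheme \<Rightarrow> nat \<Rightarrow> ('s::ab_semigroup_add \<Rightarrow> 'a) \<Rightarrow> bool" where
  "poly_map_le G 0 f \<longleftrightarrow> (\<exists>c\<in>carrier G. \<forall>s. f s = c)"
| "poly_map_le G (Suc d) f \<longleftrightarrow> (\<forall>s. f s \<in> carrier G) \<and>
     (\<forall>s. poly_map_le G d (\<lambda>t. f (s + t) \<otimes>\<^bsub>G\<^esub> inv\<^bsub>G\<^esub> f t) \<and>
          poly_map_le G d (\<lambda>t. inv\<^bsub>G\<^esub> f t \<otimes>\<^bsub>G\<^esub> f (s + t)))"

definition polynomial_map ::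
  "('a, 'b) monoid_scheme \<Rightarrow> ('s::ab_semigroup_add \<Rightarrow> 'a) \<Rightarrow> bool" where
  "polynomial_map G f \<longleftrightarrow> (\<exists>d. poly_map_le G d f)"

abbreviation polynomial_sequence :: "('a, 'b) monoid_scheme \<Rightarrow> (nat \<Rightarrow> 'a) \<Rightarrow> bool" where
  "polynomial_sequence G g \<equiv> polynomial_map G g"

end

theory Submission
  imports Defs "HOL-Computational_Algebra.Polynomial"
begin

text \<open>
  A polynomial sequence in a torsion-free abelian group behaves like an ordinary polynomial: after
  passing to a suitable multiple, it has polynomial exponents with integer coefficients, and a root
  \<open>m\<close> can be split off as a factor \<open>n - m\<close>. Each root lowers the degree by one and torsion-freeness
  allows cancelling \<open>n - m\<close>, so infinitely many roots force the sequence to be trivial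
  (\<open>poly_map_infinite_zeros\<close>).

  The nilpotent case reduces to the abelian one along the upper central series \<open>Z\<^sub>i\<close>. If \<open>g\<close> takes
  the value \<open>x\<close> infinitely often, then \<open>f n = inv x \<otimes> g n\<close> is a polynomial sequence that is trivial
  infinitely often, and it lies in some \<open>Z\<^sub>i\<close> because the group is nilpotent. It has to be pushed down
  from \<open>Z\<^sub>i\<^sub>+\<^sub>1\<close> to \<open>Z\<^sub>i\<close>. Rather than working in the quotient of these two groups, whose
  torsion-freeness would need a proof, one uses homomorphisms from \<open>Z\<^sub>i\<^sub>+\<^sub>1\<close> to the centre \<open>Z\<^sub>1\<close>, namely
  the iterated commutators \<open>u \<mapsto> [\<dots>[[u, y\<^sub>1], y\<^sub>2], \<dots>, y\<^sub>i]\<close>. Their common kernel is exactly \<open>Z\<^sub>i\<close>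
  (\<open>central_factor_separated_by_center\<close>), and the centre inherits torsion-freeness as a subgroup. A
  homomorphism \<open>\<phi>\<close> of this kind turns \<open>f\<close> into a polynomial sequence in a torsion-free abelian group
  that is trivial infinitely often, hence trivial everywhere. So all values of \<open>f\<close> lie in \<open>Z\<^sub>i\<close>, and
  at the bottom of the series \<open>f\<close> is trivial.
\<close>

section \<open>Words in a group\<close>

lemma (in group) inv_mult_cancel_left:
  assumes "x \<in> carrier G" "z \<in> carrier G"
  shows "inv x \<otimes> (x \<otimes> z) = z" "x \<otimes> (inv x \<otimes> z) = z"
  using assms by (simp_all add: m_assoc[symmetric])

lemmas (in group) word_simps = m_assoc inv_mult_group inv_mult_cancel_left

definition commutator :: "('a, 'b) monoid_scheme \<Rightarrow> 'a \<Rightarrow> 'a \<Rightarrow> 'a" where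
  "commutator G x y = x \<otimes>\<^bsub>G\<^esub> y \<otimes>\<^bsub>G\<^esub> inv\<^bsub>G\<^esub> x \<otimes>\<^bsub>G\<^esub> inv\<^bsub>G\<^esub> y"

context group
begin

lemma commutator_closed [simp, intro]:
  "x \<in> carrier G \<Longrightarrow> y \<in> carrier G \<Longrightarrow> commutator G x y \<in> carrier G"
  by (simp add: commutator_def)

lemma commutator_mult:
  assumes "x \<in> carrier G" "x' \<in> carrier G" "y \<in> carrier G"
  shows "commutator G (x \<otimes> x') y = x \<otimes> commutator G x' y \<otimes> inv x \<otimes> commutator G x y"
  using assms by (simp add: commutator_def word_simps)

text \<open>
  Here the conjugation by \<open>x\<close> is traded for a commutator of higher weight. Modulo deeper terms of a
  central series this makes \<open>x \<mapsto> [x, y]\<close> multiplicative.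
\<close>
lemma commutator_mult':
  assumes "x \<in> carrier G" "x' \<in> carrier G" "y \<in> carrier G"
  shows "commutator G (x \<otimes> x') y =
    inv (commutator G (commutator G x' y) x) \<otimes> commutator G x' y \<otimes> commutator G x y"
  using assms by (simp add: commutator_def word_simps)

lemma commutator_inv:
  assumes "x \<in> carrier G" "y \<in> carrier G"
  shows "commutator G (inv x) y = inv x \<otimes> inv (commutator G x y) \<otimes> x"
  using assms by (simp add: commutator_def word_simps)

lemma commutator_conj:
  assumes "a \<in> carrier G" "x \<in> carrier G" "y \<in> carrier G"
  shows "commutator G (a \<otimes> x \<otimes> inv a) y = a \<otimes> commutator G x (inv a \<otimes> y \<otimes> a) \<otimes> inv a"
  using assms by (simp add: commutator_def word_simps)

lemma commutator_eq_one_iff: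
  assumes "x \<in> carrier G" "y \<in> carrier G"
  shows "commutator G x y = \<one> \<longleftrightarrow> x \<otimes> y = y \<otimes> x"
proof -
  have "commutator G x y = (x \<otimes> y) \<otimes> inv (y \<otimes> x)"
    using assms by (simp add: commutator_def word_simps)
  then show ?thesis
    using assms by (metis inv_closed inv_equality inv_inv m_closed r_inv)
qed

end

section \<open>The upper central series\<close>

text \<open>
  The usual definition takes preimages of centres of quotient groups; the elementwise form used here
  is equivalent and keeps everything inside the given group.
\<close>
primrec upper_central_series :: "('a, 'b) monoid_scheme \<Rightarrow> nat \<Rightarrow> 'a set" where
  "upper_central_series G 0 = {\<one>\<^bsub>G\<^esub>}"
| "upper_central_series G (Suc i) =
     {x \<in> carrier G. \<forall>y\<in>carrier G. commutator G x y \<in> upper_central_series G i}"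

context group
begin

text \<open>
  Normality has to be carried through the induction: closure of the next term under products and
  inverses involves conjugates of commutators that lie in the present term.
\<close>
lemma upper_central_series_normal: "upper_central_series G i \<lhd> G"
proof (induction i)
  case 0
  show ?case by (simp add: normal_inv_iff triv_subgroup)
next
  case (Suc i)
  let ?Z = "upper_central_series G i"
  interpret Z: normal ?Z G by (fact Suc)
  have one: "commutator G \<one> y = \<one>" if "y \<in> carrier G" for y
    using that by (simp add: commutator_def)
  have "subgroup (upper_central_series G (Suc i)) G"
  proof
    fix x x' assume "x \<in> upper_central_series G (Suc i)" "x' \<in> upper_central_series G (Suc i)"
    then show "x \<otimes> x' \<in> upper_central_series G (Suc i)"
      by (auto simp: commutator_mult intro!: Z.m_closed Z.inv_op_closed2)
  next
    fix x assume "x \<in> upper_central_series G (Suc i)"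
    then show "inv x \<in> upper_central_series G (Suc i)"
      by (auto simp: commutator_inv intro!: Z.inv_op_closed1 Z.m_inv_closed)
  qed (auto simp: one Z.one_closed)
  moreover have "a \<otimes> x \<otimes> inv a \<in> upper_central_series G (Suc i)"
    if "a \<in> carrier G" "x \<in> upper_central_series G (Suc i)" for a x
    using that by (auto simp: commutator_conj intro!: Z.inv_op_closed2)
  ultimately show ?case by (simp add: normal_inv_iff)
qed

lemmas upper_central_series_subgroup = normal_imp_subgroup[OF upper_central_series_normal]

lemma upper_central_series_Suc: "upper_central_series G i \<subseteq> upper_central_series G (Suc i)"
proof
  interpret Z: normal "upper_central_series G i" G by (fact upper_central_series_normal)
  fix x assume x: "x \<in> upper_central_series G i"
  have "x \<otimes> (y \<otimes> inv x \<otimes> inv y) \<in> upper_central_series G i" if "y \<in> carrier G" for y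
    using x that by (intro Z.m_closed Z.inv_op_closed2 Z.m_inv_closed)
  then show "x \<in> upper_central_series G (Suc i)"
    using x by (simp add: commutator_def m_assoc)
qed

lemma center_comm_group: "comm_group (G\<lparr>carrier := upper_central_series G 1\<rparr>)"
proof -
  interpret Z: group "G\<lparr>carrier := upper_central_series G 1\<rparr>"
    by (rule subgroup.subgroup_is_group[OF upper_central_series_subgroup is_group])
  show ?thesis
    by (rule Z.group_comm_groupI) (auto simp: commutator_eq_one_iff)
qed

lemma lower_central_series_subset_carrier: "lower_central_series G n \<subseteq> carrier G"
proof (induction n)
  case (Suc n)
  then show ?case
    by (auto simp: commutator_subgroup_def intro!: generate_incl)
qed simp

text \<open>
  The lower series reaches the identity after \<open>n\<close> steps, and each step back up enlarges it by
  elements whose commutators lie in the term before; the upper series is the largest series with that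
  property. For \<open>i = n\<close> the whole group lies in the \<open>n\<close>-th term of the upper series.
\<close>
lemma lower_central_series_le_upper:
  assumes "lower_central_series G n = {\<one>}" "i \<le> n"
  shows "lower_central_series G (n - i) \<subseteq> upper_central_series G i"
  using assms(2)
proof (induction i)
  case 0
  then show ?case using assms(1) by simp
next
  case (Suc i)
  have "commutator G x y \<in> upper_central_series G i"
    if "x \<in> lower_central_series G (n - Suc i)" "y \<in> carrier G" for x y
  proof -
    have "commutator G x y \<in> lower_central_series G (Suc (n - Suc i))"
      using that unfolding lower_central_series.simps commutator_subgroup_def commutator_def
      by (intro generate.incl) blast
    then show ?thesis using Suc by (auto simp: Suc_diff_Suc)
  qed
  then show ?case using lower_central_series_subset_carrier by auto
qed

text \<open>
  This replaces the statement that the quotient of consecutive terms is torsion-free abelian. The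
  homomorphism is found by induction: if \<open>x\<close> does not lie in the lower term, then some commutator
  \<open>[x, y]\<close> avoids the term below that one, and a homomorphism \<open>\<phi>\<close> detecting \<open>[x, y]\<close> gives
  \<open>u \<mapsto> \<phi> [u, y]\<close>. Taking the commutator with \<open>y\<close> fails to be multiplicative only by an element on which \<open>\<phi>\<close> is
  trivial. Hence triviality on the lower term is part of the induction.
\<close>
lemma central_factor_separated_by_center:
  assumes "x \<in> upper_central_series G (Suc i)" "x \<notin> upper_central_series G i"
  shows "\<exists>\<phi> \<in> hom (G\<lparr>carrier := upper_central_series G (Suc i)\<rparr>) (G\<lparr>carrier := upper_central_series G 1\<rparr>).
    (\<forall>z\<in>upper_central_series G i. \<phi> z = \<one>) \<and> \<phi> x \<noteq> \<one>"
  using assms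
proof (induction i arbitrary: x)
  case 0
  then show ?case by (intro bexI[of _ "\<lambda>x. x"]) (auto simp: hom_def)
next
  case (Suc i)
  let ?Z = "upper_central_series G"
  let ?C = "G\<lparr>carrier := ?Z 1\<rparr>"
  interpret C: comm_group ?C by (rule center_comm_group)
  have sub: "?Z j \<subseteq> carrier G" for j
    using upper_central_series_subgroup subgroup.subset by blast
  have step: "commutator G u v \<in> ?Z j" if "u \<in> ?Z (Suc j)" "v \<in> carrier G" for u v j
    using that by simp
  obtain y where y: "y \<in> carrier G" "commutator G x y \<notin> ?Z i"
    using Suc.prems by auto
  obtain \<phi> where \<phi>: "\<phi> \<in> hom (G\<lparr>carrier := ?Z (Suc i)\<rparr>) ?C"
    and triv: "\<And>z. z \<in> ?Z i \<Longrightarrow> \<phi> z = \<one>" and "\<phi> (commutator G x y) \<noteq> \<one>"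
    using Suc.IH[OF step[OF Suc.prems(1) y(1)] y(2)] by blast
  have mult: "\<phi> (u \<otimes> v) = \<phi> u \<otimes> \<phi> v" if "u \<in> ?Z (Suc i)" "v \<in> ?Z (Suc i)" for u v
    using \<phi> that by (auto simp: hom_def)
  have cl: "\<phi> u \<in> ?Z 1" if "u \<in> ?Z (Suc i)" for u
    using \<phi> that by (auto simp: hom_def)
  have "\<phi> (commutator G (u \<otimes> v) y) = \<phi> (commutator G u y) \<otimes> \<phi> (commutator G v y)"
    if u: "u \<in> ?Z (Suc (Suc i))" and v: "v \<in> ?Z (Suc (Suc i))" for u v
  proof -
    let ?w = "inv (commutator G (commutator G v y) u)"
    have uG: "u \<in> carrier G" "v \<in> carrier G" using u v by auto
    have cu: "commutator G u y \<in> ?Z (Suc i)" and cv: "commutator G v y \<in> ?Z (Suc i)"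
      using step u v y by blast+
    (* ?w is the error term of commutator_mult'; it lies in the kernel of \<phi>. *)
    have w: "?w \<in> ?Z i"
      by (rule subgroup.m_inv_closed[OF upper_central_series_subgroup step[OF cv uG(1)]])
    have w': "?w \<in> ?Z (Suc i)"
      by (rule subsetD[OF upper_central_series_Suc w])
    have "\<phi> (commutator G (u \<otimes> v) y) = \<phi> ?w \<otimes> \<phi> (commutator G v y) \<otimes> \<phi> (commutator G u y)"
      unfolding commutator_mult'[OF uG y(1)]
      by (simp only: mult[OF subgroup.m_closed[OF upper_central_series_subgroup w' cv] cu] mult[OF w' cv])
    also have "\<dots> = \<phi> (commutator G v y) \<otimes> \<phi> (commutator G u y)"
      using triv[OF w] subsetD[OF sub cl[OF cv]] by (simp del: upper_central_series.simps)
    also have "\<dots> = \<phi> (commutator G u y) \<otimes> \<phi> (commutator G v y)"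
      using C.m_comm cl[OF cu] cl[OF cv] by simp
    finally show ?thesis .
  qed
  then have "(\<lambda>u. \<phi> (commutator G u y)) \<in> hom (G\<lparr>carrier := ?Z (Suc (Suc i))\<rparr>) ?C"
    using cl step y by (auto simp: hom_def simp del: upper_central_series.simps One_nat_def)
  then show ?case
    using triv step y \<open>\<phi> (commutator G x y) \<noteq> \<one>\<close>
    by (intro bexI[of _ "\<lambda>u. \<phi> (commutator G u y)"]) 
      (auto simp del: upper_central_series.simps One_nat_def)
qed

end

section \<open>Polynomial maps\<close>

lemma poly_map_le_closed:
  assumes "poly_map_le G d f" shows "f s \<in> carrier G"
  using assms by (cases d) auto

lemma poly_map_le_hom:
  fixes f :: "'s::ab_semigroup_add \<Rightarrow> 'a"
  assumes "group G" "group A" "subgroup H G" "\<phi> \<in> hom (G\<lparr>carrier := H\<rparr>) A"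
    and "poly_map_le G d f" "\<And>s. f s \<in> H"
  shows "poly_map_le A d (\<lambda>s. \<phi> (f s))"
  using assms(5,6)
proof (induction d arbitrary: f)
  case 0
  then obtain c where "\<And>s. f s = c" by auto
  then show ?case using 0(2) assms(4) by (auto simp: hom_def)
next
  case (Suc d)
  interpret G: group G by fact
  interpret H: subgroup H G by fact
  have GH: "group (G\<lparr>carrier := H\<rparr>)" by (rule H.subgroup_is_group[OF G.is_group])
  interpret \<phi>: group_hom "G\<lparr>carrier := H\<rparr>" A \<phi>
    using GH assms(2,4) by (simp add: group_hom_def group_hom_axioms_def)
  have inv: "\<phi> (inv\<^bsub>G\<^esub> u) = inv\<^bsub>A\<^esub> \<phi> u" if "u \<in> H" for u
    using \<phi>.hom_inv[of u] that G.m_inv_consistent[OF assms(3)] by simp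
  have mult: "\<phi> (u \<otimes>\<^bsub>G\<^esub> v) = \<phi> u \<otimes>\<^bsub>A\<^esub> \<phi> v" if "u \<in> H" "v \<in> H" for u v
    using \<phi>.hom_mult[of u v] that by simp
  have "poly_map_le A d (\<lambda>t. \<phi> (f (s + t) \<otimes>\<^bsub>G\<^esub> inv\<^bsub>G\<^esub> f t))"
    "poly_map_le A d (\<lambda>t. \<phi> (inv\<^bsub>G\<^esub> f t \<otimes>\<^bsub>G\<^esub> f (s + t)))" for s
    using Suc.prems by (auto intro!: Suc.IH)
  then show ?case
    using Suc.prems(2) \<phi>.hom_closed by (simp add: mult inv)
qed

text \<open>
  Left translation by \<open>a\<close> leaves the differences \<open>R\<^sub>s\<close> unchanged and conjugates the differences \<open>L\<^sub>s\<close>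
  by \<open>a\<close>, and conjugation is a homomorphism.
\<close>
lemma poly_map_le_translate:
  assumes "group G" "a \<in> carrier G" "poly_map_le G d f"
  shows "poly_map_le G d (\<lambda>s. a \<otimes>\<^bsub>G\<^esub> f s)"
proof (cases d)
  case 0
  then show ?thesis using assms by (auto intro: monoid.m_closed[OF group.is_monoid])
next
  case (Suc e)
  interpret G: group G by fact
  have cl: "f s \<in> carrier G" for s using assms(3) by (rule poly_map_le_closed)
  have "poly_map_le G e (\<lambda>t. (a \<otimes>\<^bsub>G\<^esub> f (s + t)) \<otimes>\<^bsub>G\<^esub> inv\<^bsub>G\<^esub> (a \<otimes>\<^bsub>G\<^esub> f t))" for s
  proof -
    have "poly_map_le G e (\<lambda>t. a \<otimes>\<^bsub>G\<^esub> (f (s + t) \<otimes>\<^bsub>G\<^esub> inv\<^bsub>G\<^esub> f t) \<otimes>\<^bsub>G\<^esub> inv\<^bsub>G\<^esub> a)"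
      by (rule poly_map_le_hom[where \<phi> = "\<lambda>x. a \<otimes>\<^bsub>G\<^esub> x \<otimes>\<^bsub>G\<^esub> inv\<^bsub>G\<^esub> a" and H = "carrier G"])
        (use assms Suc cl in \<open>auto simp: hom_def G.word_simps G.subgroup_self\<close>)
    then show ?thesis using assms cl by (simp add: G.word_simps)
  qed
  moreover have "poly_map_le G e (\<lambda>t. inv\<^bsub>G\<^esub> (a \<otimes>\<^bsub>G\<^esub> f t) \<otimes>\<^bsub>G\<^esub> (a \<otimes>\<^bsub>G\<^esub> f (s + t)))" for s
    using assms Suc cl by (simp add: G.word_simps)
  ultimately show ?thesis using Suc cl assms by simp
qed

section \<open>Sequences in abelian groups with polynomial exponents\<close>

text \<open>
  The sequences \<open>n \<mapsto> a\<^sub>1\<^bsup>e\<^sub>1(n)\<^esup> \<dots> a\<^sub>r\<^bsup>e\<^sub>r(n)\<^esup>\<close> with exponents from a given set \<open>E\<close>. Generating them by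
  products lets a linear statement about the exponents be transferred to the group one factor at a
  time, without indexed products and without fixing a basis of exponents.
\<close>
inductive exponent_combination ::
  "('a, 'b) monoid_scheme \<Rightarrow> (nat \<Rightarrow> int) set \<Rightarrow> (nat \<Rightarrow> 'a) \<Rightarrow> bool" for A E where
  power: "a \<in> carrier A \<Longrightarrow> e \<in> E \<Longrightarrow> exponent_combination A E (\<lambda>n. a [^]\<^bsub>A\<^esub> e n)"
| mult: "exponent_combination A E f \<Longrightarrow> exponent_combination A E g \<Longrightarrow>
    exponent_combination A E (\<lambda>n. f n \<otimes>\<^bsub>A\<^esub> g n)"

definition binomial_exponents :: "nat \<Rightarrow> (nat \<Rightarrow> int) set" where
  "binomial_exponents d = {\<lambda>n. int (n choose k) |k. k \<le> d}"

definition polynomial_exponents :: "nat \<Rightarrow> (nat \<Rightarrow> int) set" where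
  "polynomial_exponents d = {\<lambda>n. poly p (int n) |p. degree p \<le> d}"

context comm_group
begin

lemma exponent_combination_closed: "exponent_combination G E f \<Longrightarrow> f n \<in> carrier G"
  by (induction rule: exponent_combination.induct) auto

text \<open>
  Binomial exponents are used because they are closed under summation with an increase of the degree
  by one: this is Pascal's rule.
\<close>
lemma binomial_combination_antidifference:
  assumes "exponent_combination G (binomial_exponents d) f"
  shows "\<exists>F. exponent_combination G (binomial_exponents (Suc d)) F \<and> F 0 = \<one> \<and>
    (\<forall>n. F (Suc n) = F n \<otimes> f n)"
  using assms
proof (induction rule: exponent_combination.induct)
  case (power a e)
  then obtain k where k: "k \<le> d" "e = (\<lambda>n. int (n choose k))" by (auto simp: binomial_exponents_def)
  let ?F = "\<lambda>n. a [^] int (n choose Suc k)"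
  have "(\<lambda>n. int (n choose Suc k)) \<in> binomial_exponents (Suc d)"
    using k unfolding binomial_exponents_def by (intro CollectI exI[of _ "Suc k"]) auto
  then have "exponent_combination G (binomial_exponents (Suc d)) ?F"
    by (rule exponent_combination.power[OF power(1)])
  moreover have "?F (Suc n) = ?F n \<otimes> a [^] e n" for n
    using power(1) by (simp add: k(2) int_pow_mult[symmetric] add.commute)
  ultimately show ?case by (intro exI[of _ ?F]) (simp add: int_pow_def)
next
  case (mult f g)
  then obtain F F' where F: "exponent_combination G (binomial_exponents (Suc d)) F" "F 0 = \<one>"
      "\<And>n. F (Suc n) = F n \<otimes> f n"
    and F': "exponent_combination G (binomial_exponents (Suc d)) F'" "F' 0 = \<one>"
      "\<And>n. F' (Suc n) = F' n \<otimes> g n" by blast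
  have "F n \<otimes> f n \<otimes> (F' n \<otimes> g n) = F n \<otimes> F' n \<otimes> (f n \<otimes> g n)" for n
    using mult.hyps F(1) F'(1) by (simp add: exponent_combination_closed m_ac)
  then show ?case
    using F F' exponent_combination.mult[OF F(1) F'(1)]
    by (intro exI[of _ "\<lambda>n. F n \<otimes> F' n"]) auto
qed

text \<open>
  Newton's interpolation formula. The difference with step \<open>1\<close> determines a sequence up to its initial
  value, so the antidifference of the expansion of that difference is the expansion of the sequence.
\<close>
lemma poly_map_le_binomial_combination:
  assumes "poly_map_le G d (f :: nat \<Rightarrow> 'a)"
  shows "exponent_combination G (binomial_exponents d) f"
  using assms
proof (induction d arbitrary: f)
  case 0
  then obtain c where "c \<in> carrier G" "f = (\<lambda>n. c)" by auto
  moreover have "(\<lambda>n. 1) \<in> binomial_exponents 0"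
    by (auto simp: binomial_exponents_def)
  ultimately show ?case
    using exponent_combination.power[of c G "\<lambda>n. 1" "binomial_exponents 0"] by (simp add: int_pow_1)
next
  case (Suc d)
  have cl: "f n \<in> carrier G" for n using Suc.prems by (rule poly_map_le_closed)
  have "exponent_combination G (binomial_exponents d) (\<lambda>t. inv (f t) \<otimes> f (1 + t))"
    using Suc.prems by (intro Suc.IH) (simp del: One_nat_def)
  then obtain F where F: "exponent_combination G (binomial_exponents (Suc d)) F" "F 0 = \<one>"
      "\<And>n. F (Suc n) = F n \<otimes> (inv (f n) \<otimes> f (1 + n))"
    using binomial_combination_antidifference by blast
  have eq: "f n = f 0 \<otimes> F n" for n
  proof (induction n)
    case (Suc n)
    have "f 0 \<otimes> F (Suc n) = (f 0 \<otimes> F n) \<otimes> (inv (f n) \<otimes> f (1 + n))"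
      using cl exponent_combination_closed[OF F(1)] by (simp add: F(3) m_assoc)
    also have "\<dots> = f (Suc n)" using cl Suc[symmetric] by (simp add: inv_mult_cancel_left)
    finally show ?case by simp
  next
    case 0
    show ?case using cl by (simp add: F(2))
  qed
  have "(\<lambda>n. 1) \<in> binomial_exponents (Suc d)"
    unfolding binomial_exponents_def by (intro CollectI exI[of _ 0]) auto
  from exponent_combination.mult[OF exponent_combination.power[OF cl[of 0] this] F(1)]
  show ?case using cl by (simp add: int_pow_1 eq[symmetric])
qed

end

text \<open>
  A binomial coefficient has rational coefficients as a polynomial in \<open>n\<close>. One common factor \<open>d!\<close>
  clears the denominators for all \<open>k \<le> d\<close>.
\<close>
lemma fact_times_binomial_eq_poly:
  assumes "k \<le> d"
  shows "\<exists>p :: int poly. degree p \<le> d \<and> (\<forall>n. poly p (int n) = fact d * int (n choose k))"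
proof -
  have ff: "\<exists>p :: int poly. degree p \<le> k \<and> (\<forall>n. poly p (int n) = fact k * int (n choose k))" for k
  proof (induction k)
    case 0
    show ?case by (intro exI[of _ 1]) auto
  next
    case (Suc k)
    then obtain p :: "int poly" where p: "degree p \<le> k" "\<And>n. poly p (int n) = fact k * int (n choose k)"
      by blast
    have "int (Suc k) * int (n choose Suc k) = (int n - int k) * int (n choose k)" for n
    proof (cases "k \<le> n")
      case True
      then have "Suc k * (n choose Suc k) = (n - k) * (n choose k)"
        by (simp only: binomial_absorb_comp binomial_absorption)
      then show ?thesis using True by (metis of_nat_diff of_nat_mult)
    next
      case False
      then show ?thesis by (simp add: binomial_eq_0)
    qed
    then have "fact k * (int (Suc k) * int (n choose Suc k)) = fact k * ((int n - int k) * int (n choose k))" for n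
      by (simp only:)
    then have "poly ([:- int k, 1:] * p) (int n) = fact (Suc k) * int (n choose Suc k)" for n
      by (simp add: p algebra_simps)
    moreover have "degree ([:- int k, 1:] * p) \<le> Suc k"
      using degree_mult_le[of "[:- int k, 1:]" p] p(1) by simp
    ultimately show ?case by blast
  qed
  obtain p :: "int poly" where p: "degree p \<le> k" "\<And>n. poly p (int n) = fact k * int (n choose k)"
    using ff by blast
  obtain c :: int where c: "fact d = fact k * c"
    using fact_dvd[OF assms] by (metis dvdE)
  show ?thesis
    using p assms degree_smult_le[of c p] by (intro exI[of _ "smult c p"]) (auto simp: c)
qed

context comm_group
begin

lemma binomial_combination_fact_power:
  assumes "exponent_combination G (binomial_exponents d) f"
  shows "exponent_combination G (polynomial_exponents d) (\<lambda>n. f n [^] (fact d :: int))"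
  using assms
proof (induction rule: exponent_combination.induct)
  case (power a e)
  then obtain k where k: "k \<le> d" "e = (\<lambda>n. int (n choose k))" by (auto simp: binomial_exponents_def)
  obtain p :: "int poly" where p: "degree p \<le> d" "\<And>n. poly p (int n) = fact d * int (n choose k)"
    using fact_times_binomial_eq_poly[OF k(1)] by blast
  have "(\<lambda>n. poly p (int n)) \<in> polynomial_exponents d"
    using p(1) unfolding polynomial_exponents_def by blast
  from exponent_combination.power[OF power(1) this] show ?case
    using power(1) by (simp add: p(2) k(2) int_pow_pow mult.commute)
next
  case (mult f g)
  then show ?case
    using exponent_combination.mult[OF mult.IH]
    by (simp add: int_pow_distrib exponent_combination_closed)
qed

text \<open>
  The counterpart of \<open>p(n) - p(m) = (n - m) q(n)\<close>, obtained from synthetic division of every exponent.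
  Integer coefficients are what makes the quotient \<open>q\<close> again an integral exponent.
\<close>
lemma polynomial_combination_factor:
  assumes "exponent_combination G (polynomial_exponents (Suc d)) f"
  shows "\<exists>w. exponent_combination G (polynomial_exponents d) w \<and>
    (\<forall>n. f n = f m \<otimes> w n [^] (int n - int m))"
  using assms
proof (induction rule: exponent_combination.induct)
  case (power a e)
  then obtain p where p: "degree p \<le> Suc d" "e = (\<lambda>n. poly p (int n))"
    by (auto simp: polynomial_exponents_def)
  let ?q = "synthetic_div p (int m)"
  have "(\<lambda>n. poly ?q (int n)) \<in> polynomial_exponents d"
    unfolding polynomial_exponents_def using p(1) by (intro CollectI exI[of _ ?q]) (auto simp: degree_synthetic_div)
  then have "exponent_combination G (polynomial_exponents d) (\<lambda>n. a [^] poly ?q (int n))"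
    by (rule exponent_combination.power[OF power(1)])
  moreover have "a [^] e n = a [^] e m \<otimes> (a [^] poly ?q (int n)) [^] (int n - int m)" for n
  proof -
    have "poly p (int n) = poly ([:- int m, 1:] * ?q + [:poly p (int m):]) (int n)"
      by (simp only: synthetic_div_correct'[of "int m" p])
    then have "e n = e m + poly ?q (int n) * (int n - int m)"
      by (simp add: p(2) algebra_simps)
    then show ?thesis using power(1) by (simp only: int_pow_mult int_pow_pow)
  qed
  ultimately show ?case by blast
next
  case (mult f g)
  then obtain u v where u: "exponent_combination G (polynomial_exponents d) u"
      "\<And>n. f n = f m \<otimes> u n [^] (int n - int m)"
    and v: "exponent_combination G (polynomial_exponents d) v"
      "\<And>n. g n = g m \<otimes> v n [^] (int n - int m)" by blast
  have cl: "f n \<in> carrier G" "g n \<in> carrier G" "u n \<in> carrier G" "v n \<in> carrier G" for n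
    using mult.hyps u(1) v(1) by (auto intro: exponent_combination_closed)
  have "f n \<otimes> g n = f m \<otimes> g m \<otimes> (u n \<otimes> v n) [^] (int n - int m)" for n
  proof -
    have "f n \<otimes> g n = (f m \<otimes> u n [^] (int n - int m)) \<otimes> (g m \<otimes> v n [^] (int n - int m))"
      by (rule arg_cong2[OF u(2) v(2)])
    also have "\<dots> = f m \<otimes> g m \<otimes> (u n \<otimes> v n) [^] (int n - int m)"
      using cl by (simp add: int_pow_distrib m_ac)
    finally show ?thesis .
  qed
  then show ?case using exponent_combination.mult[OF u(1) v(1)] by blast
qed

end

lemma torsion_free_int_pow:
  fixes G (structure)
  assumes "torsion_free_group G" "x \<in> carrier G" "x [^]\<^bsub>G\<^esub> (k::int) = \<one>\<^bsub>G\<^esub>" "k \<noteq> 0"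
  shows "x = \<one>\<^bsub>G\<^esub>"
proof -
  interpret group G using assms(1) by (simp add: torsion_free_group_def)
  have "x [^] (- k) = \<one>" using assms(2,3) by (simp add: int_pow_neg)
  then have "x [^] \<bar>k\<bar> = \<one>" using assms(3) by (simp add: abs_if)
  then have "x [^] nat \<bar>k\<bar> = \<one>" using int_pow_int[of G x "nat \<bar>k\<bar>"] by simp
  moreover have "0 < nat \<bar>k\<bar>" using assms(4) by simp
  ultimately show ?thesis using assms(1,2) unfolding torsion_free_group_def by blast
qed

context comm_group
begin

text \<open>
  Splitting off one root \<open>m\<close> leaves \<open>f n = w n [^] (n - m)\<close> with \<open>w\<close> of smaller degree. As there is no
  torsion, \<open>w\<close> is trivial at every root of \<open>f\<close> other than \<open>m\<close>.
\<close>
lemma polynomial_combination_infinite_zeros: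
  assumes "torsion_free_group G" "exponent_combination G (polynomial_exponents d) f"
    "infinite {n. f n = \<one>}"
  shows "f n = \<one>"
  using assms(2,3)
proof (induction d arbitrary: f n)
  case 0
  have "f i = f j" for i j
    using 0(1)
  proof (induction rule: exponent_combination.induct)
    case (power a e)
    then show ?case by (auto simp: polynomial_exponents_def elim!: degree_eq_zeroE)
  next
    case (mult f g)
    then show ?case by simp
  qed
  moreover obtain m where "f m = \<one>" using 0(2) not_finite_existsD by blast
  ultimately show ?case by metis
next
  case (Suc d)
  obtain m where m: "f m = \<one>" using Suc.prems(2) not_finite_existsD by blast
  obtain w where w: "exponent_combination G (polynomial_exponents d) w"
      "\<And>n. f n = f m \<otimes> w n [^] (int n - int m)"
    using polynomial_combination_factor[OF Suc.prems(1)] by blast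
  have cl: "w n \<in> carrier G" for n using w(1) by (rule exponent_combination_closed)
  have f: "f n = w n [^] (int n - int m)" for n using w(2)[of n] m cl by simp
  have "{n. f n = \<one>} \<subseteq> insert m {n. w n = \<one>}"
    using torsion_free_int_pow[OF assms(1) cl] by (auto simp: f)
  then have "infinite {n. w n = \<one>}"
    using Suc.prems(2) finite_subset by (metis finite_insert)
  then show ?case using Suc.IH[OF w(1)] by (simp add: f)
qed

text \<open>
  The \<open>d!\<close>-th power of \<open>f\<close> has exponents with integer coefficients and is trivial wherever \<open>f\<close> is;
  the factor \<open>d!\<close> is cancelled again at the end.
\<close>
lemma poly_map_infinite_zeros:
  assumes "torsion_free_group G" "poly_map_le G d (f :: nat \<Rightarrow> 'a)" "infinite {n. f n = \<one>}"
  shows "f n = \<one>"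
proof -
  have comb: "exponent_combination G (polynomial_exponents d) (\<lambda>n. f n [^] (fact d :: int))"
    by (intro binomial_combination_fact_power poly_map_le_binomial_combination assms)
  have "{n. f n = \<one>} \<subseteq> {n. f n [^] (fact d :: int) = \<one>}" by auto
  then have "infinite {n. f n [^] (fact d :: int) = \<one>}"
    using assms(3) finite_subset by blast
  from polynomial_combination_infinite_zeros[OF assms(1) comb this]
  have "f n [^] (fact d :: int) = \<one>" .
  then show ?thesis
    using torsion_free_int_pow[OF assms(1) poly_map_le_closed[OF assms(2)]] by simp
qed

end

section \<open>Descent along the upper central series\<close>

lemma torsion_free_subgroup:
  fixes G (structure)
  assumes "torsion_free_group G" "subgroup H G"
  shows "torsion_free_group (G\<lparr>carrier := H\<rparr>)"
proof -
  interpret group G using assms(1) by (simp add: torsion_free_group_def)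
  have "group (G\<lparr>carrier := H\<rparr>)" by (rule subgroup.subgroup_is_group[OF assms(2) is_group])
  moreover have "x = \<one>" if "x \<in> H" "0 < n" "x [^]\<^bsub>G\<lparr>carrier := H\<rparr>\<^esub> n = \<one>" for x and n :: nat
  proof -
    have "x [^] n = \<one>" using that(3) nat_pow_consistent[of x n H] by simp
    then show ?thesis
      using assms(1) that(2) subgroup.mem_carrier[OF assms(2) that(1)] by (auto simp: torsion_free_group_def)
  qed
  ultimately show ?thesis unfolding torsion_free_group_def by simp
qed

text \<open>
  A value outside the next lower term would be detected by a homomorphism to the centre, and the image
  of \<open>f\<close> under it would be a nontrivial polynomial sequence with infinitely many zeros in a
  torsion-free abelian group.
\<close>
lemma (in group) poly_map_descends_central_series:
  assumes "torsion_free_group G" "poly_map_le G d (f :: nat \<Rightarrow> 'a)" "infinite {n. f n = \<one>}"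
    and "\<And>n. f n \<in> upper_central_series G i"
  shows "f n = \<one>"
  using assms(4)
proof (induction i)
  case 0
  then show ?case by simp
next
  case (Suc i)
  let ?C = "G\<lparr>carrier := upper_central_series G 1\<rparr>"
  interpret C: comm_group ?C by (rule center_comm_group)
  have "f n \<in> upper_central_series G i" for n
  proof (rule ccontr)
    assume "f n \<notin> upper_central_series G i"
    from central_factor_separated_by_center[OF Suc.prems this]
    obtain \<phi> where \<phi>: "\<phi> \<in> hom (G\<lparr>carrier := upper_central_series G (Suc i)\<rparr>) ?C"
        "\<forall>z\<in>upper_central_series G i. \<phi> z = \<one>" and ne: "\<phi> (f n) \<noteq> \<one>"
      by blast
    have "poly_map_le ?C d (\<lambda>n. \<phi> (f n))"
      by (rule poly_map_le_hom[OF is_group C.is_group upper_central_series_subgroup \<phi>(1) assms(2) Suc.prems])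
    moreover have "\<phi> \<one> = \<one>"
      using \<phi>(2) subgroup.one_closed[OF upper_central_series_subgroup] by blast
    then have "{n. f n = \<one>} \<subseteq> {n. \<phi> (f n) = \<one>}" by auto
    then have "infinite {n. \<phi> (f n) = \<one>\<^bsub>?C\<^esub>}" using assms(3) finite_subset by auto
    ultimately have "\<phi> (f n) = \<one>\<^bsub>?C\<^esub>"
      by (intro C.poly_map_infinite_zeros[of d "\<lambda>n. \<phi> (f n)"]
          torsion_free_subgroup[OF assms(1) upper_central_series_subgroup])
    then show False using ne by simp
  qed
  then show ?case by (rule Suc.IH)
qed

theorem theorem12:
  fixes G :: "('a, 'b) monoid_scheme" and g :: "nat \<Rightarrow> 'a"
  assumes "group G" and "fin_gen_group G" and "torsion_free_group G" and "nilpotent_group G"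
    and "polynomial_sequence G g"
  shows "(\<exists>x. infinite {i. g i = x}) \<longleftrightarrow> (\<exists>c. \<forall>i. g i = c)"
proof
  interpret group G by fact
  obtain d where d: "poly_map_le G d g" using assms(5) by (auto simp: polynomial_map_def)
  have cl: "g i \<in> carrier G" for i using d by (rule poly_map_le_closed)
  obtain n where n: "lower_central_series G n = {\<one>\<^bsub>G\<^esub>}"
    using assms(4) by (auto simp: nilpotent_group_def)
  have Z: "carrier G \<subseteq> upper_central_series G n"
    using lower_central_series_le_upper[OF n, of n] by simp
  assume "\<exists>x. infinite {i. g i = x}"
  then obtain x where inf: "infinite {i. g i = x}" by blast
  then obtain k where "g k = x" using not_finite_existsD by blast
  then have x: "x \<in> carrier G" using cl by blast
  let ?h = "\<lambda>i. inv\<^bsub>G\<^esub> x \<otimes>\<^bsub>G\<^esub> g i"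
  have h: "poly_map_le G d ?h"
    using poly_map_le_translate[OF assms(1) _ d] x by simp
  have "{i. g i = x} \<subseteq> {i. ?h i = \<one>\<^bsub>G\<^esub>}" using x by auto
  then have "infinite {i. ?h i = \<one>\<^bsub>G\<^esub>}" using inf finite_subset by blast
  then have "?h i = \<one>\<^bsub>G\<^esub>" for i
    by (rule poly_map_descends_central_series[OF assms(3) h]) (use Z cl x in blast)
  then have "x \<otimes>\<^bsub>G\<^esub> ?h i = x" for i using x by simp
  then have "g i = x" for i using x cl by (simp add: inv_mult_cancel_left)
  then show "\<exists>c. \<forall>i. g i = c" by blast
next
  assume "\<exists>c. \<forall>i. g i = c"
  then obtain c where "\<And>i. g i = c" by blast
  then have "infinite {i. g i = c}" by simp
  then show "\<exists>x. infinite {i. g i = x}" by blast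
qed

end
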